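(* Let $n\ge 1$ and $m\ge 1$ be integers, let $G$ be a finite region-connected $n$-simplex graph with chromatic number $\chi(G)=n+1$, and fix a proper coloring of the vertices of $G$ with the $n+1$ colors $i_0,i_1,\dots,i_n$, with associated product $P$ as defined in the context. Let $L_1,L_2:V(G)\to \mathbb{Z}/m\mathbb{Z}$ be two labelings of $G$. Then there exists a finite collection $F$ of pushes (repetitions allowed) such that $F[L_1(G)]=L_2(G)$ (i.e. applying the pushes in $F$ successively changes $L_1$ into $L_2$) if and only if $P[L_1(G)]=P[L_2(G)]$.
   Context: Simplicial complex: a simplicial complex on a finite vertex set $V$ is a collection $\Delta$ of subsets of $V$ with $\{v\}\in\Delta$ for all $v\in V$ and such that $F\in\Delta$, $H\subseteq F$ imply $H\in\Delta$. A $k$-simplex is a member of $\Delta$ with exactly $k+1$ vertices. $n$-simplex graph: a simplicial complex $G$ such that for every $F\in G$ with $|F|<n+1$ there is $K\in G$ with $F\subsetneq K$. (Equivalently viewed as a graph: a union of complete graphs on $n+1$ vertices.) Its vertices are $V(G)$, its edges are its $1$-simplexes, and $\chi(G)$ is the chromatic number of the graph so obtained. The $n$-simplexes of $G$ are called its regions. Region-connectedness: two $n$-simplexes are adjacent if their intersection is an $(n-1)$-simplex (they share exactly $n$ vertices). A region-path from $S$ to $S'$ is a finite sequence of $n$-simplexes starting at $S$ and ending at $S'$ in which consecutive ones are adjacent. $G$ is region-connected if any two of its $n$-simplexes are joined by a region-path. Labelings and pushes: a labeling of $G$ is a map $L:V(G)\to\mathbb{Z}/m\mathbb{Z}$. For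 an $n$-simplex $S$ of $G$, the push on $S$ is the operation on labelings that adds $1$ (mod $m$) to the label of each vertex of $S$ and leaves all other labels unchanged. Colors and the product $P$: for $0\le k<n$ let $i_k$ be the $n\times n$ complex diagonal matrix with entry $e^{2\pi \mathrm{i}/m}$ in position $k+1$ on the diagonal and $1$ in all other diagonal positions; let $i_n=e^{2\pi \mathrm{i}(m-1)/m}I_n$. The vertices of $G$ are properly colored with these $n+1$ symbols (adjacent vertices get different symbols); let $i(v)\in\{i_0,\dots,i_n\}$ denote the color of $v$. For a labeling $L$ put $P[L(G)]=\prod_{v\in V(G)} i(v)^{L(v)}$, which is well defined since each $i_k^m=I_n$. *)

theory Defs
  imports "Jordan_Normal_Form.Matrix" "HOL-Algebra.FiniteProduct" "HOL-Library.FuncSet"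
    Complex_Main
begin

definition simplicial_complex :: "'a set \<Rightarrow> 'a set set \<Rightarrow> bool" where
  "simplicial_complex V \<Delta> \<longleftrightarrow> finite V \<and> \<Delta> \<subseteq> Pow V \<and> (\<forall>v\<in>V. {v} \<in> \<Delta>) \<and>
     (\<forall>F\<in>\<Delta>. \<forall>H. H \<subseteq> F \<longrightarrow> H \<in> \<Delta>)"

definition simplexes :: "nat \<Rightarrow> 'a set set \<Rightarrow> 'a set set" where
  "simplexes k \<Delta> = {F \<in> \<Delta>. card F = k + 1}"

definition simplex_graph :: "nat \<Rightarrow> 'a set \<Rightarrow> 'a set set \<Rightarrow> bool" where
  "simplex_graph n V \<Delta> \<longleftrightarrow> simplicial_complex V \<Delta> \<and>
     (\<forall>F\<in>\<Delta>. card F < n + 1 \<longrightarrow> (\<exists>K\<in>\<Delta>. F \<subset> K))"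

definition proper_coloring :: "'a set \<Rightarrow> 'a set set \<Rightarrow> nat set \<Rightarrow> ('a \<Rightarrow> nat) \<Rightarrow> bool" where
  "proper_coloring V \<Delta> C c \<longleftrightarrow> c \<in> V \<rightarrow> C \<and>
     (\<forall>u\<in>V. \<forall>v\<in>V. {u, v} \<in> simplexes 1 \<Delta> \<longrightarrow> c u \<noteq> c v)"

definition chromatic_number :: "'a set \<Rightarrow> 'a set set \<Rightarrow> nat" where
  "chromatic_number V \<Delta> = (LEAST k. \<exists>c. proper_coloring V \<Delta> {..<k} c)"

definition adjacent_regions :: "nat \<Rightarrow> 'a set set \<Rightarrow> 'a set \<Rightarrow> 'a set \<Rightarrow> bool" where
  "adjacent_regions n \<Delta> S S' \<longleftrightarrow>
     S \<in> simplexes n \<Delta> \<and> S' \<in> simplexes n \<Delta> \<and> S \<inter> S' \<in> simplexes (n - 1) \<Delta>"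

definition region_path :: "nat \<Rightarrow> 'a set set \<Rightarrow> 'a set \<Rightarrow> 'a set list \<Rightarrow> 'a set \<Rightarrow> bool" where
  "region_path n \<Delta> S p S' \<longleftrightarrow> p \<noteq> [] \<and> hd p = S \<and> last p = S' \<and>
     set p \<subseteq> simplexes n \<Delta> \<and> successively (adjacent_regions n \<Delta>) p"

definition region_connected :: "nat \<Rightarrow> 'a set set \<Rightarrow> bool" where
  "region_connected n \<Delta> \<longleftrightarrow>
     (\<forall>S\<in>simplexes n \<Delta>. \<forall>S'\<in>simplexes n \<Delta>. \<exists>p. region_path n \<Delta> S p S')"

text \<open>The ring of integers modulo \<open>m\<close> is represented by the residues \<open>{..<m}\<close>. Labelings are
  extensional, i.e. \<open>undefined\<close> outside the vertex set, so that equality of functions is equality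
  of labelings.\<close>

definition labelings :: "nat \<Rightarrow> 'a set \<Rightarrow> ('a \<Rightarrow> nat) set" where
  "labelings m V = V \<rightarrow>\<^sub>E {..<m}"

definition push :: "nat \<Rightarrow> 'a set \<Rightarrow> ('a \<Rightarrow> nat) \<Rightarrow> ('a \<Rightarrow> nat)" where
  "push m S L = (\<lambda>v. if v \<in> S then (L v + 1) mod m else L v)"

text \<open>The colors are used as formal symbols: \<open>k \<le> n\<close> stands for the symbol \<open>i\<^sub>k\<close>, whose matrix is
  \<open>color_mat n m k\<close>. Different symbols may have equal matrices, e.g. for \<open>m = 1\<close>. Rows and columns
  are counted from 0, so position \<open>k + 1\<close> on the diagonal has index \<open>k\<close>.\<close>

definition color_mat :: "nat \<Rightarrow> nat \<Rightarrow> nat \<Rightarrow> complex mat" where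
  "color_mat n m k =
     (if k < n
      then mat n n (\<lambda>(i, j). if i = j then (if i = k then exp (2 * of_real pi * \<i> / of_nat m) else 1) else 0)
      else exp (2 * of_real pi * \<i> * (of_nat m - 1) / of_nat m) \<cdot>\<^sub>m 1\<^sub>m n)"

text \<open>The finite product \<open>finprod\<close> needs a commutative monoid, hence the restriction of the ring of
  \<open>n \<times> n\<close> matrices to the diagonal ones.\<close>

definition diag_monoid :: "nat \<Rightarrow> (complex mat, unit) ring_scheme" where
  "diag_monoid n = (ring_mat TYPE(complex) n ())
     \<lparr>carrier := {A \<in> carrier_mat n n. diagonal_mat A}\<rparr>"

definition label_product :: "nat \<Rightarrow> nat \<Rightarrow> 'a set \<Rightarrow> ('a \<Rightarrow> nat) \<Rightarrow> ('a \<Rightarrow> nat) \<Rightarrow> complex mat" where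
  "label_product n m V c L = finprod (diag_monoid n) (\<lambda>v. color_mat n m (c v) ^\<^sub>m L v) V"

lemma diag_mult_index:
  assumes "A \<in> carrier_mat n n" "B \<in> carrier_mat n n" "diagonal_mat A" "diagonal_mat B"
    and "i < n" "j < n"
  shows "(A * B) $$ (i, j) = (if i = j then A $$ (i, i) * B $$ (i, i) else (0 :: complex))"
proof -
  have "(A * B) $$ (i, j) = (\<Sum>k\<in>{0..<n}. A $$ (i, k) * B $$ (k, j))"
    using assms by (simp add: scalar_prod_def)
  also have "\<dots> = (\<Sum>k\<in>{0..<n}. if k = i then A $$ (i, i) * B $$ (i, j) else 0)"
    using assms by (intro sum.cong) (auto simp: diagonal_mat_def)
  also have "\<dots> = A $$ (i, i) * B $$ (i, j)"
    using assms by simp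
  finally show ?thesis
    using assms by (auto simp: diagonal_mat_def)
qed

lemma comm_monoid_diag_monoid: "comm_monoid (diag_monoid n)"
proof -
  have closed: "diagonal_mat (A * B)"
    if "A \<in> carrier_mat n n" "B \<in> carrier_mat n n" "diagonal_mat A" "diagonal_mat B"
    for A B :: "complex mat"
    unfolding diagonal_mat_def
  proof (intro allI impI)
    fix i j assume "i < dim_row (A * B)" "j < dim_col (A * B)" "i \<noteq> j"
    then show "(A * B) $$ (i, j) = 0"
      using that diag_mult_index[OF that, of i j] by simp
  qed
  have comm: "A * B = B * A"
    if "A \<in> carrier_mat n n" "B \<in> carrier_mat n n" "diagonal_mat A" "diagonal_mat B"
    for A B :: "complex mat"
    using that by (intro eq_matI) (simp_all add: diag_mult_index del: index_mult_mat(1))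
  have one: "diagonal_mat (1\<^sub>m n :: complex mat)"
    by (simp add: diagonal_mat_def)
  show ?thesis
    by (rule comm_monoidI)
      (auto simp: diag_monoid_def ring_mat_simps closed comm one assoc_mult_mat[of _ n n _ n _ n])
qed

lemma color_mat_in_carrier: "color_mat n m k \<in> carrier (diag_monoid n)"
  by (auto simp: color_mat_def diag_monoid_def diagonal_mat_def)

lemma color_mat_pow_index:
  assumes "i < n" "j < n"
  shows "(color_mat n m k ^\<^sub>m l) $$ (i, j) =
    (if i = j then color_mat n m k $$ (i, i) ^ l else 0)
    \<and> color_mat n m k ^\<^sub>m l \<in> carrier (diag_monoid n)"
  using assms
proof (induction l arbitrary: i j)
  case 0
  then show ?case using color_mat_in_carrier[of n m k]
    by (auto simp: diag_monoid_def diagonal_mat_def)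
next
  case (Suc l)
  interpret comm_monoid "diag_monoid n" by (rule comm_monoid_diag_monoid)
  have c: "color_mat n m k ^\<^sub>m l \<in> carrier (diag_monoid n)" using Suc by blast
  have "color_mat n m k ^\<^sub>m Suc l \<in> carrier (diag_monoid n)"
    using m_closed[OF c color_mat_in_carrier[of n m k]]
    by (simp add: diag_monoid_def ring_mat_simps)
  moreover have "(color_mat n m k ^\<^sub>m l * color_mat n m k) $$ (i, j) =
      (if i = j then (color_mat n m k ^\<^sub>m l) $$ (i, i) * color_mat n m k $$ (i, i) else 0)"
    using c color_mat_in_carrier[of n m k] Suc.prems
    by (intro diag_mult_index) (auto simp: diag_monoid_def)
  ultimately show ?case using Suc by (simp add: mult.commute)
qed

lemma color_mat_pow_order:
  assumes "m \<ge> 1"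
  shows "color_mat n m k ^\<^sub>m m = 1\<^sub>m n"
proof (rule eq_matI)
  fix i j assume "i < dim_row (1\<^sub>m n :: complex mat)" "j < dim_col (1\<^sub>m n :: complex mat)"
  then have ij: "i < n" "j < n" by auto
  have e: "exp (2 * of_real pi * \<i> / of_nat m) ^ m = (1 :: complex)"
    using assms by (simp flip: exp_of_nat_mult)
  have "exp (2 * of_real pi * \<i> * (of_nat m - 1) / of_nat m) ^ m
      = exp (of_nat (m - 1) * (2 * of_real pi * \<i>))"
    using assms by (simp add: of_nat_diff mult_ac flip: exp_of_nat_mult)
  also have "\<dots> = (1 :: complex)"
    by (simp only: exp_of_nat_mult exp_two_pi_i power_one)
  finally have f: "exp (2 * of_real pi * \<i> * (of_nat m - 1) / of_nat m) ^ m = (1 :: complex)" .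
  show "(color_mat n m k ^\<^sub>m m) $$ (i, j) = (1\<^sub>m n) $$ (i, j)"
    using color_mat_pow_index[OF ij, of m k m] ij e f by (auto simp: color_mat_def)
qed (auto simp: color_mat_def)

end

theory Submission
  imports Defs "HOL-Number_Theory.Cong"
begin

text \<open>Let \<open>s\<^sub>k(L)\<close> be the sum of the labels on the vertices of color \<open>k\<close>. The \<open>k\<close>-th diagonal entry of
  \<open>P[L]\<close> is \<open>\<omega>\<close> to the power \<open>s\<^sub>k(L) - s\<^sub>n(L)\<close> with \<open>\<omega> = exp (2\<pi>\<i> / m)\<close>, and every region has exactly
  one vertex of each color, so a push raises all \<open>s\<^sub>k\<close> by one and preserves \<open>P\<close>. Conversely, the
  label changes realizable by pushes form a group. For adjacent regions \<open>S\<close> and \<open>S'\<close> it contains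
  \<open>1\<^sub>S - 1\<^sub>S\<^sub>'\<close>, which is \<open>\<delta>\<^sub>u - \<delta>\<^sub>w\<close> for the two exchanged vertices, and these have equal colors.
  Following region-paths, it contains \<open>\<delta>\<^sub>u - \<delta>\<^sub>w\<close> for all \<open>u\<close>, \<open>w\<close> of equal color, so any change can be
  moved to a single region \<open>S\<close>; if \<open>P\<close> agrees, the result is a multiple of \<open>1\<^sub>S\<close>.\<close>

section \<open>Regions and colors\<close>

lemma simplex_subset:
  assumes "simplicial_complex V \<Delta>" "S \<in> simplexes k \<Delta>"
  shows "S \<subseteq> V"
  using assms by (auto simp: simplicial_complex_def simplexes_def)

text \<open>Closure under subsets makes any two vertices of a face span an edge, so a proper
  coloring separates them.\<close>

lemma inj_on_proper_coloring:
  assumes "simplicial_complex V \<Delta>" "proper_coloring V \<Delta> C c" "F \<in> \<Delta>"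
  shows "inj_on c F"
proof (rule inj_onI, rule ccontr)
  fix u v assume uv: "u \<in> F" "v \<in> F" "c u = c v" "u \<noteq> v"
  then have "{u, v} \<in> simplexes 1 \<Delta>" "u \<in> V" "v \<in> V"
    using assms(1,3) unfolding simplexes_def simplicial_complex_def by auto
  then show False
    using assms(2) uv(3) by (auto simp: proper_coloring_def)
qed

text \<open>By counting: the \<open>n + 1\<close> vertices carry distinct colors out of only
  \<open>n + 1\<close>.\<close>

lemma bij_betw_region_coloring:
  assumes "simplicial_complex V \<Delta>" "proper_coloring V \<Delta> {0..n} c" "S \<in> simplexes n \<Delta>"
  shows "bij_betw c S {0..n}"
proof -
  have inj: "inj_on c S"
    using inj_on_proper_coloring[OF assms(1,2)] assms(3) by (simp add: simplexes_def)
  have "c ` S \<subseteq> {0..n}"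
    using simplex_subset[OF assms(1,3)] assms(2) by (auto simp: proper_coloring_def)
  moreover have "card (c ` S) = card {0..n}"
    using assms(3) card_image[OF inj] by (simp add: simplexes_def)
  ultimately show ?thesis
    using inj card_subset_eq[of "{0..n}"] by (simp add: bij_betw_def)
qed

text \<open>Keep enlarging the face. It is colored injectively with \<open>n + 1\<close> colors, so
  its size is at most \<open>n + 1\<close> and the process stops exactly at a region.\<close>

lemma simplex_graph_region_extension:
  assumes "simplex_graph n V \<Delta>" "proper_coloring V \<Delta> {0..n} c" "F \<in> \<Delta>"
  shows "\<exists>S\<in>simplexes n \<Delta>. F \<subseteq> S"
  using assms(3)
proof (induction "n + 1 - card F" arbitrary: F rule: less_induct)
  case less
  have sc: "simplicial_complex V \<Delta>"
    using assms(1) by (simp add: simplex_graph_def)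
  have fin: "finite K" and le: "card K \<le> n + 1" if "K \<in> \<Delta>" for K
  proof -
    have "K \<subseteq> V" "finite V"
      using sc that by (auto simp: simplicial_complex_def)
    then show "finite K" by (rule finite_subset)
    have "c ` K \<subseteq> {0..n}"
      using \<open>K \<subseteq> V\<close> assms(2) by (auto simp: proper_coloring_def)
    then show "card K \<le> n + 1"
      using card_mono[of "{0..n}" "c ` K"] card_image[OF inj_on_proper_coloring[OF sc assms(2) that]]
      by simp
  qed
  show ?case
  proof (cases "card F < n + 1")
    case True
    then obtain K where K: "K \<in> \<Delta>" "F \<subset> K"
      using assms(1) less.prems by (auto simp: simplex_graph_def)
    then have "card F < card K"
      using fin by (simp add: psubset_card_mono)
    with True have "n + 1 - card K < n + 1 - card F"
      by simp
    from less.hyps[OF this K(1)] obtain S where "S \<in> simplexes n \<Delta>" "K \<subseteq> S"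
      by blast
    then show ?thesis using K(2) by blast
  next
    case False
    then have "F \<in> simplexes n \<Delta>"
      using le[OF less.prems] less.prems by (simp add: simplexes_def)
    then show ?thesis by blast
  qed
qed

lemma adjacent_regions_exchange:
  assumes "adjacent_regions n \<Delta> S S'" "n \<ge> 1" "u \<in> S - S'" "w \<in> S' - S"
  shows "S - S' = {u}" "S' - S = {w}"
proof -
  \<comment> \<open>Truncated subtraction: \<open>n - 1 + 1 = n\<close> relies on
    \<open>n \<ge> 1\<close>.\<close>
  have card: "card S = n + 1" "card S' = n + 1" "card (S \<inter> S') = n"
    using assms(1,2) by (auto simp: adjacent_regions_def simplexes_def)
  \<comment> \<open>An infinite set has \<open>card\<close> 0, so a positive cardinality yields
    finiteness.\<close>
  then have "finite (S \<inter> S')"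
    using assms(2) by (intro card_ge_0_finite) simp
  then have "card (S - S') = 1" "card (S' - S) = 1"
    using card card_Diff_subset_Int[of S S'] card_Diff_subset_Int[of S' S]
    by (simp_all add: Int_commute)
  then show "S - S' = {u}" "S' - S = {w}"
    using assms(3,4) by (metis card_1_singletonE singletonD)+
qed

section \<open>The product in terms of color class sums\<close>

text \<open>The sum stays unreduced in \<open>nat\<close>, so that it can serve as an exponent of a
  root of unity.\<close>

definition class_sum :: "'a set \<Rightarrow> ('a \<Rightarrow> nat) \<Rightarrow> nat \<Rightarrow> ('a \<Rightarrow> nat) \<Rightarrow> nat" where
  "class_sum V c k L = (\<Sum>v | v \<in> V \<and> c v = k. L v)"

lemma exp_root_of_unity_power_eq_iff:
  fixes m a b :: nat
  assumes "m \<ge> 1"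
  defines "\<omega> \<equiv> exp (2 * of_real pi * \<i> / of_nat m) :: complex"
  shows "\<omega> ^ a = \<omega> ^ b \<longleftrightarrow> [a = b] (mod m)"
proof -
  have pow: "\<omega> ^ k = cis (2 * pi * real k / real m)" for k
    by (simp add: \<omega>_def cis_conv_exp mult_ac flip: exp_of_nat_mult)
  have "\<omega> ^ m = 1"
    using assms(1) by (simp add: \<omega>_def flip: exp_of_nat_mult)
  then have mod: "\<omega> ^ k = \<omega> ^ (k mod m)" for k
    by (metis div_mult_mod_eq mult.commute mult_1 power_add power_mult power_one)
  \<comment> \<open>Exponents below \<open>m\<close> enumerate the \<open>m\<close>-th roots of
    unity without repetition.\<close>
  have "inj_on (\<lambda>k. \<omega> ^ k) {..<m}"
    using bij_betw_roots_unity[of m] assms(1) by (simp add: pow bij_betw_def)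
  then have "\<omega> ^ (a mod m) = \<omega> ^ (b mod m) \<longleftrightarrow> a mod m = b mod m"
    using assms(1) by (intro inj_on_eq_iff) auto
  then show ?thesis
    using mod[of a] mod[of b] by (simp add: cong_def)
qed

text \<open>Diagonal matrices multiply entrywise. Carrier membership is part of the induction,
  because the entrywise rule applies to the partial product only once that is known to be
  diagonal.\<close>

lemma finprod_diag_monoid_index:
  assumes "finite A" "f \<in> A \<rightarrow> carrier (diag_monoid n)"
  shows "finprod (diag_monoid n) f A \<in> carrier (diag_monoid n) \<and>
    (\<forall>i<n. finprod (diag_monoid n) f A $$ (i, i) = (\<Prod>v\<in>A. f v $$ (i, i)))"
  using assms
proof (induction A)
  case empty
  interpret comm_monoid "diag_monoid n" by (rule comm_monoid_diag_monoid)
  show ?case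
    using one_closed by (simp add: finprod_empty) (simp add: diag_monoid_def ring_mat_simps)
next
  case (insert x A)
  interpret comm_monoid "diag_monoid n" by (rule comm_monoid_diag_monoid)
  have fx: "f x \<in> carrier (diag_monoid n)" and fA: "f \<in> A \<rightarrow> carrier (diag_monoid n)"
    using insert.prems by auto
  let ?P = "finprod (diag_monoid n) f A"
  have P: "?P \<in> carrier (diag_monoid n)" using insert.IH[OF fA] by blast
  have eq: "finprod (diag_monoid n) f (insert x A) = f x * ?P"
    unfolding finprod_insert[OF insert.hyps fA fx] by (simp add: diag_monoid_def ring_mat_simps)
  have "(f x * ?P) $$ (i, i) = f x $$ (i, i) * ?P $$ (i, i)" if "i < n" for i
    using fx P that diag_mult_index[of "f x" n ?P i i] by (simp add: diag_monoid_def)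
  moreover have "f x * ?P \<in> carrier (diag_monoid n)"
    using m_closed[OF fx P] by (simp add: diag_monoid_def ring_mat_simps)
  ultimately show ?case
    using insert eq fA by simp
qed

lemma diag_monoid_eq_iff:
  assumes "A \<in> carrier (diag_monoid n)" "B \<in> carrier (diag_monoid n)"
  shows "A = B \<longleftrightarrow> (\<forall>i<n. A $$ (i, i) = B $$ (i, i))"
proof
  assume diag: "\<forall>i<n. A $$ (i, i) = B $$ (i, i)"
  show "A = B"
  proof (rule eq_matI)
    fix i j assume "i < dim_row B" "j < dim_col B"
    then show "A $$ (i, j) = B $$ (i, j)"
      using assms diag by (cases "i = j") (auto simp: diag_monoid_def diagonal_mat_def)
  qed (use assms in \<open>auto simp: diag_monoid_def\<close>)
qed auto

text \<open>Membership is extracted from a statement about a matrix entry, so some index must exist;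
  \<open>n \<ge> 1\<close> supplies the entry (0, 0).\<close>

lemma color_mat_pow_carrier:
  assumes "n \<ge> 1"
  shows "color_mat n m k ^\<^sub>m l \<in> carrier (diag_monoid n)"
  using color_mat_pow_index[of 0 n 0 m k l] assms by simp

lemma label_product_carrier:
  assumes "finite V" "n \<ge> 1"
  shows "label_product n m V c L \<in> carrier (diag_monoid n)"
  using finprod_diag_monoid_index[OF assms(1)] color_mat_pow_carrier[OF assms(2)]
  by (simp add: label_product_def)

lemma label_product_index:
  assumes "finite V" "i < n" "m \<ge> 1" "c \<in> V \<rightarrow> {0..n}"
  shows "label_product n m V c L $$ (i, i) =
    exp (2 * of_real pi * \<i> / of_nat m) ^ (class_sum V c i L + (m - 1) * class_sum V c n L)"
proof -
  define \<omega> where "\<omega> = (exp (2 * of_real pi * \<i> / of_nat m) :: complex)"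
  \<comment> \<open>Color \<open>n\<close> scales by the inverse of \<omega>, written as the power
    \<open>m - 1\<close> to keep exponents natural.\<close>
  have \<omega>': "exp (2 * of_real pi * \<i> * (of_nat m - 1) / of_nat m) = \<omega> ^ (m - 1)"
    using assms(3) by (simp add: \<omega>_def of_nat_diff mult_ac flip: exp_of_nat_mult)
  have "label_product n m V c L $$ (i, i) = (\<Prod>v\<in>V. (color_mat n m (c v) ^\<^sub>m L v) $$ (i, i))"
    using finprod_diag_monoid_index[OF assms(1)] color_mat_pow_carrier[of n] assms(2)
    by (simp add: label_product_def)
  \<comment> \<open>Only the colors \<open>i\<close> and \<open>n\<close>, distinct since
    \<open>i < n\<close>, are nontrivial at position \<open>i\<close>. One factor for each lets the
    product split into two class sums.\<close>
  also have "\<dots> = (\<Prod>v\<in>V. (if c v = i then \<omega> ^ L v else 1) *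
      (if c v = n then \<omega> ^ ((m - 1) * L v) else 1))"
  proof (rule prod.cong)
    fix v assume "v \<in> V"
    then have "c v \<le> n" using assms(4) by auto
    have "(color_mat n m (c v) ^\<^sub>m L v) $$ (i, i) = (color_mat n m (c v) $$ (i, i)) ^ L v"
      using color_mat_pow_index[of i n i m "c v" "L v"] assms(2) by simp
    then show "(color_mat n m (c v) ^\<^sub>m L v) $$ (i, i) = (if c v = i then \<omega> ^ L v else 1) *
        (if c v = n then \<omega> ^ ((m - 1) * L v) else 1)"
      using \<open>c v \<le> n\<close> assms(2) \<omega>'
      by (auto simp: color_mat_def power_mult simp flip: \<omega>_def)
  qed simp
  also have "\<dots> = \<omega> ^ class_sum V c i L * \<omega> ^ ((m - 1) * class_sum V c n L)"
    using assms(1)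
    by (simp add: prod.distrib class_sum_def power_sum sum_distrib_left prod.inter_filter
        del: One_nat_def)
  finally show ?thesis by (simp add: power_add \<omega>_def)
qed

lemma label_product_eq_iff:
  assumes "finite V" "n \<ge> 1" "m \<ge> 1" "c \<in> V \<rightarrow> {0..n}"
  shows "label_product n m V c L = label_product n m V c L' \<longleftrightarrow>
    (\<forall>k<n. [int (class_sum V c k L) - int (class_sum V c n L)
          = int (class_sum V c k L') - int (class_sum V c n L')] (mod int m))"
proof -
  have "[a + (m - 1) * b = a' + (m - 1) * b'] (mod m) \<longleftrightarrow>
      [int a - int b = int a' - int b'] (mod int m)" for a b a' b' :: nat
  proof -
    \<comment> \<open>Since \<open>m - 1\<close> is -1 modulo \<open>m\<close>, the two differences
      agree up to a multiple of \<open>m\<close>.\<close>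
    have "(int a + (int m - 1) * int b) - (int a' + (int m - 1) * int b') =
        ((int a - int b) - (int a' - int b')) + int m * (int b - int b')"
      by (simp add: algebra_simps)
    then have "int m dvd (int a + (int m - 1) * int b) - (int a' + (int m - 1) * int b') \<longleftrightarrow>
        int m dvd (int a - int b) - (int a' - int b')"
      by (simp only: dvd_add_left_iff[OF dvd_triv_left])
    then show ?thesis
      using assms(3) by (simp add: cong_iff_dvd_diff of_nat_diff flip: cong_int_iff)
  qed
  then show ?thesis
    using assms
    by (simp add: diag_monoid_eq_iff[OF label_product_carrier label_product_carrier]
        label_product_index exp_root_of_unity_power_eq_iff)
qed

text \<open>The region meets the color class in a single vertex \<open>x\<close>. The result is a
  congruence because \<open>push\<close> reduces the label of \<open>x\<close> modulo
  \<open>m\<close>.\<close>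

lemma class_sum_push:
  assumes "finite V" "S \<subseteq> V" "bij_betw c S {0..n}" "k \<le> n"
  shows "[class_sum V c k (push m S L) = class_sum V c k L + 1] (mod m)"
proof -
  let ?A = "{v \<in> V. c v = k}"
  obtain x where x: "x \<in> S" "c x = k"
    using assms(3,4) by (metis atLeastAtMost_iff bij_betw_iff_bijections zero_le)
  then have S: "v \<in> S \<longleftrightarrow> v = x" if "v \<in> ?A" for v
    using assms(3) that by (auto simp: bij_betw_def inj_on_def)
  have "[class_sum V c k (push m S L) = (\<Sum>v\<in>?A. L v + (if v = x then 1 else 0))] (mod m)"
    unfolding class_sum_def by (rule cong_sum) (use S in \<open>auto simp: push_def cong_def\<close>)
  also have "(\<Sum>v\<in>?A. L v + (if v = x then 1 else 0)) = class_sum V c k L + 1"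
    using assms(1,2) x by (auto simp: class_sum_def sum.distrib)
  finally show ?thesis .
qed

section \<open>Realizable label changes\<close>

text \<open>Changes are integer valued so that they can be subtracted. Reduction and restriction to
  \<open>V\<close> turn the result into an extensional labeling again.\<close>

definition shift :: "nat \<Rightarrow> 'a set \<Rightarrow> ('a \<Rightarrow> int) \<Rightarrow> ('a \<Rightarrow> nat) \<Rightarrow> 'a \<Rightarrow> nat" where
  "shift m V f L = (\<lambda>v\<in>V. nat ((int (L v) + f v) mod int m))"

text \<open>The pushes may depend on \<open>L\<close>, but every \<open>L\<close> is covered; hence
  changes compose, the second one starting from the outcome of the first.\<close>

definition realizable :: "nat \<Rightarrow> 'a set \<Rightarrow> 'a set set \<Rightarrow> ('a \<Rightarrow> int) \<Rightarrow> bool" where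
  "realizable m V R f \<longleftrightarrow>
     (\<forall>L\<in>labelings m V. \<exists>F. set F \<subseteq> R \<and> fold (push m) F L = shift m V f L)"

section \<open>The group of realizable changes modulo \<open>m\<close>\<close>

lemma shift_in_labelings:
  assumes "m \<ge> 1"
  shows "shift m V f L \<in> labelings m V"
  using assms by (auto simp: shift_def labelings_def nat_less_iff)

lemma shift_shift:
  assumes "m \<ge> 1"
  shows "shift m V g (shift m V f L) = shift m V (\<lambda>v. f v + g v) L"
  using assms by (auto simp: shift_def fun_eq_iff mod_simps add.assoc)

text \<open>Passing from one labeling to another is thus reduced to realizing their
  difference.\<close>

lemma shift_diff:
  assumes "L' \<in> labelings m V"
  shows "shift m V (\<lambda>v. int (L' v) - int (L v)) L = L'"
proof -
  have "nat (int (L' v) mod int m) = L' v" if "v \<in> V" for v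
    using assms that by (auto simp: labelings_def PiE_iff simp flip: of_nat_mod)
  then show ?thesis
    using assms by (auto simp: shift_def labelings_def fun_eq_iff PiE_iff extensional_def)
qed

lemma realizable_cong:
  assumes "realizable m V R f" "\<And>v. v \<in> V \<Longrightarrow> [f v = g v] (mod int m)"
  shows "realizable m V R g"
proof -
  have "shift m V f L = shift m V g L" for L
    using assms(2) by (auto simp: shift_def fun_eq_iff cong_def intro: mod_add_cong arg_cong[of _ _ nat])
  then show ?thesis
    using assms(1) by (simp add: realizable_def)
qed

lemma realizable_0: "realizable m V R (\<lambda>v. 0)"
  unfolding realizable_def
proof
  fix L assume "L \<in> labelings m V"
  then have "fold (push m) [] L = shift m V (\<lambda>v. 0) L"
    using shift_diff[of L m V L] by simp
  then show "\<exists>F. set F \<subseteq> R \<and> fold (push m) F L = shift m V (\<lambda>v. 0) L"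
    by (metis empty_set empty_subsetI)
qed

lemma realizable_add:
  assumes "m \<ge> 1" "realizable m V R f" "realizable m V R g"
  shows "realizable m V R (\<lambda>v. f v + g v)"
  unfolding realizable_def
proof
  fix L assume "L \<in> labelings m V"
  then obtain F where F: "set F \<subseteq> R" "fold (push m) F L = shift m V f L"
    using assms(2) by (auto simp: realizable_def)
  obtain G where "set G \<subseteq> R" "fold (push m) G (shift m V f L) = shift m V g (shift m V f L)"
    using assms(3) shift_in_labelings[OF assms(1), of V f L] by (auto simp: realizable_def)
  then have "set (F @ G) \<subseteq> R \<and> fold (push m) (F @ G) L = shift m V (\<lambda>v. f v + g v) L"
    using F assms(1) by (simp add: shift_shift)
  then show "\<exists>F. set F \<subseteq> R \<and> fold (push m) F L = shift m V (\<lambda>v. f v + g v) L" ..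
qed

text \<open>Pushes only add, but modulo \<open>m\<close> the factor \<open>k\<close> can be replaced
  by a natural number, and natural multiples are repetitions. With \<open>k = -1\<close> this
  provides inverses.\<close>

lemma realizable_int_mult:
  assumes "m \<ge> 1" "realizable m V R f"
  shows "realizable m V R (\<lambda>v. k * f v)"
proof -
  have "realizable m V R (\<lambda>v. int l * f v)" for l
  proof (induction l)
    case 0
    then show ?case by (simp add: realizable_0)
  next
    case (Suc l)
    then show ?case
      using realizable_add[OF assms(1) assms(2) Suc] by (simp add: algebra_simps)
  qed
  from this[of "nat (k mod int m)"] show ?thesis
    by (rule realizable_cong) (use assms(1) in \<open>simp add: cong_def mod_simps\<close>)
qed

lemma realizable_diff:
  assumes "m \<ge> 1" "realizable m V R f" "realizable m V R g"
  shows "realizable m V R (\<lambda>v. f v - g v)"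
  using realizable_add[OF assms(1,2) realizable_int_mult[OF assms(1,3), of "-1"]] by simp

lemma realizable_sum:
  assumes "m \<ge> 1" "finite A" "\<And>a. a \<in> A \<Longrightarrow> realizable m V R (f a)"
  shows "realizable m V R (\<lambda>v. \<Sum>a\<in>A. f a v)"
  using assms(2,3)
proof (induction A)
  case empty
  then show ?case by (simp add: realizable_0)
next
  case (insert a A)
  then show ?case
    using realizable_add[OF assms(1), of V R "f a" "\<lambda>v. \<Sum>a\<in>A. f a v"] by simp
qed

section \<open>Changes obtained from regions and region-paths\<close>

lemma realizable_region:
  assumes "S \<in> R" "S \<subseteq> V"
  shows "realizable m V R (\<lambda>v. of_bool (v \<in> S))"
  unfolding realizable_def
proof
  fix L assume "L \<in> labelings m V"
  then have "fold (push m) [S] L = shift m V (\<lambda>v. of_bool (v \<in> S)) L"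
    using assms(2)
    by (auto simp: shift_def push_def labelings_def PiE_iff extensional_def fun_eq_iff nat_mod_as_int
        add.commute)
  then show "\<exists>F. set F \<subseteq> R \<and> fold (push m) F L = shift m V (\<lambda>v. of_bool (v \<in> S)) L"
    using assms(1) by (metis empty_set empty_subsetI insert_subset list.simps(15))
qed

lemma realizable_adjacent:
  assumes "m \<ge> 1" "n \<ge> 1" "simplicial_complex V \<Delta>" "proper_coloring V \<Delta> {0..n} c"
    and adj: "adjacent_regions n \<Delta> S S'" and "u \<in> S" "w \<in> S'" "c u = c w"
  shows "realizable m V (simplexes n \<Delta>) (\<lambda>v. of_bool (v = u) - of_bool (v = w))"
proof (cases "u = w")
  case True
  then show ?thesis by (simp add: realizable_0)
next
  case False
  have S: "S \<in> simplexes n \<Delta>" "S' \<in> simplexes n \<Delta>"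
    using adj by (auto simp: adjacent_regions_def)
  \<comment> \<open>If \<open>u\<close> were also in \<open>S'\<close>, injectivity there would
    force \<open>u = w\<close>; likewise for \<open>w\<close> in \<open>S\<close>. So these are the
    exchanged vertices.\<close>
  have "inj_on c S" "inj_on c S'"
    using bij_betw_region_coloring[OF assms(3,4)] S by (auto simp: bij_betw_def)
  then have "u \<in> S - S'" "w \<in> S' - S"
    using False assms(6-8) by (auto simp: inj_on_def)
  note ex = adjacent_regions_exchange[OF adj \<open>n \<ge> 1\<close> this]
  have "realizable m V (simplexes n \<Delta>) (\<lambda>v. of_bool (v \<in> S) - of_bool (v \<in> S'))"
    using S simplex_subset[OF assms(3)] assms(1) by (intro realizable_diff realizable_region) auto
  moreover have "of_bool (v \<in> S) - of_bool (v \<in> S') = (of_bool (v = u) - of_bool (v = w) :: int)" for v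
    using ex by (auto simp: of_bool_def)
  ultimately show ?thesis by simp
qed

text \<open>Each step trades the current vertex for the vertex \<open>x\<close> of the same color in
  the next region, and the differences telescope.\<close>

lemma realizable_region_path:
  assumes "m \<ge> 1" "n \<ge> 1" "simplicial_complex V \<Delta>" "proper_coloring V \<Delta> {0..n} c"
    and "region_path n \<Delta> S p S'" "u \<in> S" "w \<in> S'" "c u = c w"
  shows "realizable m V (simplexes n \<Delta>) (\<lambda>v. of_bool (v = u) - of_bool (v = w))"
  using assms(5-8)
proof (induction p arbitrary: S u)
  case Nil
  then show ?case by (simp add: region_path_def)
next
  case (Cons T p)
  have [simp]: "T = S" and S: "S \<in> simplexes n \<Delta>"
    using Cons.prems(1) by (auto simp: region_path_def)
  have bij: "bij_betw c S {0..n}"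
    using bij_betw_region_coloring[OF assms(3,4) S] .
  show ?case
  proof (cases p)
    case Nil
    \<comment> \<open>On a one-region path both vertices lie in \<open>S\<close>, where a color
      determines its vertex.\<close>
    then have "S' = S" using Cons.prems(1) by (simp add: region_path_def)
    then have "u = w"
      using inj_onD[OF bij_betw_imp_inj_on[OF bij]] Cons.prems(2-4) by simp
    then show ?thesis by (simp add: realizable_0)
  next
    case (Cons T' q)
    have adj: "adjacent_regions n \<Delta> S T'" and path: "region_path n \<Delta> T' p S'"
      using Cons.prems(1) Cons by (auto simp: region_path_def)
    have "bij_betw c T' {0..n}"
      using bij_betw_region_coloring[OF assms(3,4)] adj by (simp add: adjacent_regions_def)
    then have "c u \<in> c ` T'"
      using bij Cons.prems(2) by (auto simp: bij_betw_def)
    then obtain x where x: "x \<in> T'" "c u = c x" by auto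
    have ux: "realizable m V (simplexes n \<Delta>) (\<lambda>v. of_bool (v = u) - of_bool (v = x))"
      using realizable_adjacent[OF assms(1-4) adj Cons.prems(2) x] .
    have xw: "realizable m V (simplexes n \<Delta>) (\<lambda>v. of_bool (v = x) - of_bool (v = w))"
      using Cons.IH[OF path x(1) Cons.prems(3)] x(2) Cons.prems(4) by simp
    show ?thesis
      using realizable_add[OF assms(1) ux xw] by simp
  qed
qed

text \<open>Fix a region \<open>S\<close> and let \<open>r v\<close> be its vertex with the color of
  \<open>v\<close>. Modulo \<open>m\<close>, \<open>D\<close> is the sum of \<open>D v\<close> times
  (\<delta> at \<open>v\<close> minus \<delta> at \<open>r v\<close>), plus \<open>d\<close> times
  the indicator of \<open>S\<close>.\<close>

lemma realizable_equal_class_sums: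
  assumes "m \<ge> 1" "n \<ge> 1" "simplex_graph n V \<Delta>" "region_connected n \<Delta>"
    and "proper_coloring V \<Delta> {0..n} c"
    and sums: "\<And>k. k \<le> n \<Longrightarrow> [(\<Sum>v | v \<in> V \<and> c v = k. D v) = d] (mod int m)"
  shows "realizable m V (simplexes n \<Delta>) D"
proof (cases "V = {}")
  \<comment> \<open>Without vertices there is no region to collect the change on, but every
    \<open>D\<close> agrees with 0 on \<open>V\<close>.\<close>
  case True
  then show ?thesis
    by (intro realizable_cong[OF realizable_0]) simp
next
  case False
  have sc: "simplicial_complex V \<Delta>"
    using assms(3) by (simp add: simplex_graph_def)
  then have fin: "finite V"
    by (simp add: simplicial_complex_def)
  have region: "\<exists>S\<in>simplexes n \<Delta>. v \<in> S" if "v \<in> V" for v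
    using simplex_graph_region_extension[OF assms(3,5), of "{v}"] sc that
    by (auto simp: simplicial_complex_def)
  with False obtain S where S: "S \<in> simplexes n \<Delta>" by blast
  have bij: "bij_betw c S {0..n}"
    using bij_betw_region_coloring[OF sc assms(5) S] .
  have "\<exists>x\<in>S. c x = c v" if "v \<in> V" for v
  proof -
    have "c v \<in> c ` S"
      using bij assms(5) that by (auto simp: bij_betw_def proper_coloring_def)
    then show ?thesis by auto
  qed
  then obtain r where r: "r v \<in> S" "c (r v) = c v" if "v \<in> V" for v
    by metis
  have "realizable m V (simplexes n \<Delta>) (\<lambda>w. of_bool (w = v) - of_bool (w = r v))" if "v \<in> V" for v
  proof -
    obtain T where T: "T \<in> simplexes n \<Delta>" "v \<in> T" using region \<open>v \<in> V\<close> by blast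
    obtain p where "region_path n \<Delta> T p S"
      using assms(4) T(1) S by (auto simp: region_connected_def)
    then show ?thesis
      using realizable_region_path[OF assms(1,2) sc assms(5)] T(2) r[OF that] by simp
  qed
  then have "realizable m V (simplexes n \<Delta>)
      (\<lambda>w. (\<Sum>v\<in>V. D v * (of_bool (w = v) - of_bool (w = r v))) + d * of_bool (w \<in> S))"
    by (intro realizable_add realizable_sum realizable_int_mult realizable_region)
      (use assms(1) fin S simplex_subset[OF sc S] in auto)
  then show ?thesis
  proof (rule realizable_cong)
    fix w assume w: "w \<in> V"
    have *: "(\<Sum>v\<in>V. D v * of_bool (w = v)) = D w"
      using fin w by (simp add: of_bool_def if_distrib cong: if_cong)
    \<comment> \<open>The amount collected at \<open>w\<close> is the whole class sum of its color,
      hence \<open>d\<close> modulo \<open>m\<close>, if \<open>w\<close> lies in \<open>S\<close>,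
      and nothing otherwise.\<close>
    have X: "[(\<Sum>v\<in>V. D v * of_bool (w = r v)) = d * of_bool (w \<in> S)] (mod int m)"
    proof (cases "w \<in> S")
      case True
      then have "w = r v \<longleftrightarrow> c v = c w" if "v \<in> V" for v
        using inj_on_eq_iff[OF bij_betw_imp_inj_on[OF bij] True r(1)[OF that]] r(2)[OF that] by metis
      then have "(\<Sum>v\<in>V. D v * of_bool (w = r v)) = (\<Sum>v\<in>V. if c v = c w then D v else 0)"
        by (intro sum.cong) simp_all
      also have "\<dots> = (\<Sum>v | v \<in> V \<and> c v = c w. D v)"
        using fin by (simp add: sum.inter_filter)
      finally have "(\<Sum>v\<in>V. D v * of_bool (w = r v)) = (\<Sum>v | v \<in> V \<and> c v = c w. D v)" .
      moreover have "c w \<le> n"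
        using assms(5) w by (auto simp: proper_coloring_def)
      ultimately show ?thesis
        using sums[of "c w"] True by simp
    next
      case False
      then have "(\<Sum>v\<in>V. D v * of_bool (w = r v)) = 0"
        using r by (intro sum.neutral) auto
      then show ?thesis using False by simp
    qed
    show "[(\<Sum>v\<in>V. D v * (of_bool (w = v) - of_bool (w = r v))) + d * of_bool (w \<in> S) = D w]
        (mod int m)"
      \<comment> \<open>The amount subtracted at \<open>w\<close> is restored by the
        \<open>S\<close> term, leaving \<open>D w\<close>.\<close>
      using cong_add[OF cong_refl cong_sym[OF X], of "D w - (\<Sum>v\<in>V. D v * of_bool (w = r v))"]
      by (simp only: right_diff_distrib sum_subtractf diff_add_cancel *)
  qed
qed

section \<open>Reachability by pushes and equality of products\<close>

theorem theorem4p1: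
  fixes n m :: nat and V :: "'a set" and \<Delta> :: "'a set set"
    and c L\<^sub>1 L\<^sub>2 :: "'a \<Rightarrow> nat"
  assumes "n \<ge> 1" and "m \<ge> 1"
    and "simplex_graph n V \<Delta>"
    and "region_connected n \<Delta>"
    and "chromatic_number V \<Delta> = n + 1"
    and "proper_coloring V \<Delta> {0..n} c"
    and "L\<^sub>1 \<in> labelings m V" and "L\<^sub>2 \<in> labelings m V"
  shows "(\<exists>F. set F \<subseteq> simplexes n \<Delta> \<and> fold (push m) F L\<^sub>1 = L\<^sub>2) \<longleftrightarrow>
    label_product n m V c L\<^sub>1 = label_product n m V c L\<^sub>2"
proof -
  have sc: "simplicial_complex V \<Delta>" and fin: "finite V" and c: "c \<in> V \<rightarrow> {0..n}"
    using assms(3,6) by (auto simp: simplex_graph_def simplicial_complex_def proper_coloring_def)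
  note eq_iff = label_product_eq_iff[OF fin assms(1,2) c]
  have push: "label_product n m V c (push m S L) = label_product n m V c L"
    if "S \<in> simplexes n \<Delta>" for S L
    unfolding eq_iff
  proof (intro allI impI)
    fix k assume "k < n"
    note step = class_sum_push[OF fin simplex_subset[OF sc that]
        bij_betw_region_coloring[OF sc assms(6) that], of _ m L]
    \<comment> \<open>Both class sums grow by one modulo \<open>m\<close>, so their difference is
      kept.\<close>
    have "[int (class_sum V c k (push m S L)) - int (class_sum V c n (push m S L))
        = int (class_sum V c k L + 1) - int (class_sum V c n L + 1)] (mod int m)"
      using \<open>k < n\<close> by (intro cong_diff) (simp_all only: cong_int_iff step less_imp_le order_refl)
    then show "[int (class_sum V c k (push m S L)) - int (class_sum V c n (push m S L))
        = int (class_sum V c k L) - int (class_sum V c n L)] (mod int m)"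
      by simp
  qed
  have "label_product n m V c (fold (push m) F L) = label_product n m V c L"
    if "set F \<subseteq> simplexes n \<Delta>" for F L
    using that by (induction F arbitrary: L) (simp_all add: push)
  moreover have "\<exists>F. set F \<subseteq> simplexes n \<Delta> \<and> fold (push m) F L\<^sub>1 = L\<^sub>2"
    if P: "label_product n m V c L\<^sub>1 = label_product n m V c L\<^sub>2"
  proof -
    define D where "D v = int (L\<^sub>2 v) - int (L\<^sub>1 v)" for v
    have D: "(\<Sum>v | v \<in> V \<and> c v = k. D v) = int (class_sum V c k L\<^sub>2) - int (class_sum V c k L\<^sub>1)" for k
      by (simp add: D_def sum_subtractf class_sum_def)
    \<comment> \<open>Equal products say that each class \<open>k\<close> changes by the same total
      as class \<open>n\<close>; that total serves as the common value \<open>d\<close>.\<close>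
    have "[(\<Sum>v | v \<in> V \<and> c v = k. D v) = (\<Sum>v | v \<in> V \<and> c v = n. D v)] (mod int m)" if "k \<le> n" for k
    proof (cases "k = n")
      case False
      then have "int m dvd (int (class_sum V c k L\<^sub>2) - int (class_sum V c n L\<^sub>2))
          - (int (class_sum V c k L\<^sub>1) - int (class_sum V c n L\<^sub>1))"
        using P[symmetric] that unfolding eq_iff by (simp add: cong_iff_dvd_diff)
      then show ?thesis
        unfolding D cong_iff_dvd_diff by (simp add: algebra_simps)
    qed simp
    then have "realizable m V (simplexes n \<Delta>) D"
      by (rule realizable_equal_class_sums[OF assms(2,1,3,4,6)])
    \<comment> \<open>Realizability of \<open>D\<close> is applied to \<open>L\<^sub>1\<close>,
      which the shift by \<open>D\<close> carries to \<open>L\<^sub>2\<close>.\<close>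
    then show ?thesis
      using assms(7) shift_diff[OF assms(8), of L\<^sub>1]
      unfolding realizable_def D_def[abs_def] by metis
  qed
  ultimately show ?thesis by metis
qed

end
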